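(* Let $t\in\mathbb{Z}\setminus\{-1,0,1\}$ and put $A(t)=(A_0(t),A_1(t),A_2(t),A_3(t),A_4(t))$ with $$A_0(t)=64t^2(1-t^8),\quad A_1(t)=t^2+1,\quad A_2(t)=-(t^2+1),\quad A_3(t)=t^2-1,\quad A_4(t)=-(t^2-1).$$ Then the diagonal quintic threefold $\mathcal{V}_{A(t)}:\ \sum_{i=0}^{4}A_i(t)X_i^5=0$ contains infinitely many non-trivial integer points.
   Context: For $A=(A_0,\dots,A_4)\in\mathbb{Z}^5$, $\mathcal{V}_A$ denotes the variety $\sum_{i=0}^4 A_iX_i^5=0$. An integer point $(X_0,\dots,X_4)\in\mathbb{Z}^5$ on $\mathcal{V}_A$ is called non-trivial if $\gcd(X_0,\dots,X_4)=1$ and no proper (nonempty) sub-sum of $\sum_{i=0}^4 A_iX_i^5$ vanishes. *)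

theory Defs
  imports Complex_Main
begin

text \<open>Elements of $\mathbb{Z}^5$ are integer lists of length 5, with coordinates \<open>X ! 0, \<dots>, X ! 4\<close>.\<close>

definition diag_quintic_points :: "int list \<Rightarrow> int list set" where
  "diag_quintic_points A = {X. length X = 5 \<and> (\<Sum>i\<in>{0..4}. A ! i * (X ! i) ^ 5) = 0}"

definition nontrivial_point :: "int list \<Rightarrow> int list \<Rightarrow> bool" where
  "nontrivial_point A X \<longleftrightarrow>
     X \<in> diag_quintic_points A \<and>
     Gcd (set X) = 1 \<and>
     (\<forall>I. I \<noteq> {} \<and> I \<subset> {0..4} \<longrightarrow> (\<Sum>i\<in>I. A ! i * (X ! i) ^ 5) \<noteq> 0)"

definition A_coeffs :: "int \<Rightarrow> int list" where
  "A_coeffs t = [64 * t^2 * (1 - t^8), t^2 + 1, - (t^2 + 1), t^2 - 1, - (t^2 - 1)]"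

end

theory Submission
  imports Defs
begin

text \<open>
  Put \<open>a = t\<^sup>2 + 1\<close> and \<open>b = t\<^sup>2 - 1\<close>, so that
  \<open>64 t\<^sup>2 (t\<^sup>8 - 1) = 8 a b (a\<^sup>4 - b\<^sup>4)\<close>. The substitution
  \<open>X = (c, p + c b, p - c b, q - c a, q + c a)\<close> completes squares: the equation becomes
  \<open>(p\<^sup>2 + c\<^sup>2 b\<^sup>2)\<^sup>2 = (q\<^sup>2 + c\<^sup>2 a\<^sup>2)\<^sup>2\<close>, which follows from
  \<open>p\<^sup>2 - q\<^sup>2 = (2 t c)\<^sup>2\<close>. We take \<open>c = m\<close>, \<open>p = m\<^sup>2 + t\<^sup>2\<close>, \<open>q = m\<^sup>2 - t\<^sup>2\<close>.
  If \<open>m\<close> is prime to \<open>t\<close>, the point is primitive. Modulo \<open>m\<close> a sub-sum is \<open>t\<^sup>1\<^sup>0\<close> times a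
  signed sum of some of \<open>a, a, b, b\<close>, so for \<open>m > 4 t\<^sup>2\<close> it can vanish only if this signed
  sum does; the few remaining sub-sums are treated directly.
\<close>

definition quintic_point :: "int \<Rightarrow> int \<Rightarrow> int list" where
  "quintic_point t m =
     [m, m^2 + t^2 + m * (t^2 - 1), m^2 + t^2 - m * (t^2 - 1),
      m^2 - t^2 - m * (t^2 + 1), m^2 - t^2 + m * (t^2 + 1)]"

lemma diff_fifth_powers:
  fixes p d :: int
  shows "(p + d)^5 - (p - d)^5 = 2 * d * (5 * (p^2 + d^2)^2 - 4 * d^4)"
  by algebra

lemma quintic_identity:
  fixes t m :: int
  shows "64 * t^2 * (1 - t^8) * m^5
    + (t^2 + 1) * ((m^2 + t^2 + m * (t^2 - 1))^5 - (m^2 + t^2 - m * (t^2 - 1))^5)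
    + (t^2 - 1) * ((m^2 - t^2 - m * (t^2 + 1))^5 - (m^2 - t^2 + m * (t^2 + 1))^5) = 0"
proof -
  \<comment> \<open>\<open>r\<close> is common to both pairs because
    \<open>(m^2 + t^2)^2 - (m^2 - t^2)^2\<close> and
    \<open>m^2 * ((t^2 + 1)^2 - (t^2 - 1)^2)\<close> both equal
    \<open>4 * m^2 * t^2\<close>.\<close>
  define r where "r = (m^2 + t^2)^2 + (m * (t^2 - 1))^2"
  have r: "(m^2 - t^2)^2 + (m * (t^2 + 1))^2 = r"
    unfolding r_def by algebra
  have 1: "(m^2 + t^2 + m * (t^2 - 1))^5 - (m^2 + t^2 - m * (t^2 - 1))^5
      = 2 * (m * (t^2 - 1)) * (5 * r^2 - 4 * (m * (t^2 - 1))^4)"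
    by (simp only: diff_fifth_powers r_def)
  have 2: "(m^2 - t^2 - m * (t^2 + 1))^5 - (m^2 - t^2 + m * (t^2 + 1))^5
      = - (2 * (m * (t^2 + 1)) * (5 * r^2 - 4 * (m * (t^2 + 1))^4))"
    using diff_fifth_powers[of "m^2 - t^2" "m * (t^2 + 1)"] unfolding r
    by (simp add: algebra_simps)
  \<comment> \<open>The terms in \<open>r^2\<close> carry the same weight with opposite signs and
    cancel, leaving only multiples of \<open>m^5\<close>.\<close>
  show ?thesis
    unfolding 1 2 by algebra
qed

lemma sum_atLeast0_atMost4:
  fixes f :: "nat \<Rightarrow> 'a::comm_monoid_add"
  shows "(\<Sum>i\<in>{0..4}. f i) = f 0 + (f 1 + (f 2 + (f 3 + f 4)))"
proof -
  have "{0..4::nat} = {0, 1, 2, 3, 4}" by auto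
  then show ?thesis by simp
qed

lemma quintic_point_on_variety:
  "quintic_point t m \<in> diag_quintic_points (A_coeffs t)"
  using quintic_identity[of t m]
  unfolding right_diff_distrib[of "t^2 + 1"] right_diff_distrib[of "t^2 - 1"]
  by (simp add: diag_quintic_points_def quintic_point_def A_coeffs_def sum_atLeast0_atMost4
      del: minus_add_distrib minus_diff_eq)

lemma Gcd_quintic_point:
  assumes "coprime m t"
  shows "Gcd (set (quintic_point t m)) = 1"
proof -
  let ?g = "Gcd (set (quintic_point t m))"
  have m: "?g dvd m" and x: "?g dvd m^2 + t^2 + m * (t^2 - 1)"
    by (rule Gcd_dvd, simp add: quintic_point_def)+
  have "t^2 = (m^2 + t^2 + m * (t^2 - 1)) - m * (m + t^2 - 1)"
    by algebra
  then have "?g dvd t^2"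
    using m x by (metis dvd_diff dvd_mult2)
  with m assms have "is_unit ?g"
    by (meson coprime_common_divisor coprime_power_right_iff)
  then show ?thesis by simp
qed

lemma dvd_power_diff_self:
  fixes x y m :: "'a::comm_ring_1"
  assumes "m dvd x - y"
  shows "m dvd x^n - y^n"
proof (cases n)
  case (Suc k)
  show ?thesis
    unfolding Suc diff_power_eq_sum using assms by (rule dvd_mult2)
qed simp

lemma odd_power_strict_mono:
  fixes x y :: "'a::linordered_idom"
  assumes "odd n" "x < y"
  shows "x^n < y^n"
proof (cases "0 \<le> x")
  case True
  then show ?thesis
    using assms by (intro power_strict_mono) (auto elim: oddE)
next
  case False
  show ?thesis
  proof (cases "0 \<le> y")
    case True
    then show ?thesis
      using False assms by (meson not_le order_less_le_trans power_less_zero_eq zero_le_power)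
  next
    case False
    then have "(- y)^n < (- x)^n"
      using assms by (intro power_strict_mono) (auto elim: oddE)
    then show ?thesis
      using assms by simp
  qed
qed

text \<open>The \<open>a\<close> part is 0 or has absolute value \<open>a\<close>, the
  \<open>b\<close> part 0 or \<open>b\<close>; as \<open>0 < b < a\<close>, they cancel only if both
  are 0.\<close>

lemma signed_sum_eq_0_cases:
  fixes a b :: int and P Q R S :: bool
  assumes "0 < b" "b < a"
    and "a * of_bool P - a * of_bool Q - b * of_bool R + b * of_bool S = 0"
  shows "P = Q \<and> R = S"
  using assms by (cases P; cases Q; cases R; cases S) auto

lemma quintic_subsum_nonzero:
  fixes t m :: int
  assumes t: "t \<notin> {-1, 0, 1}" and cop: "coprime m t" and big: "m > 4 * t^2"
    and I: "I \<noteq> {}" "I \<subset> {0..4}"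
  shows "(\<Sum>i\<in>I. A_coeffs t ! i * (quintic_point t m ! i) ^ 5) \<noteq> 0"
proof
  let ?f = "\<lambda>i. A_coeffs t ! i * (quintic_point t m ! i) ^ 5"
  let ?e = "\<lambda>i::nat. of_bool (i \<in> I) :: int"
  assume zero: "sum ?f I = 0"
  define a b where "a = t^2 + 1" and "b = t^2 - 1"
  define x1 x2 x3 x4 where "x1 = m^2 + t^2 + m * b" and "x2 = m^2 + t^2 - m * b"
    and "x3 = m^2 - t^2 - m * a" and "x4 = m^2 - t^2 + m * a"
  define U where "U = 64 * t^2 * (1 - t^8) * m^5"
  \<comment> \<open>The signs at \<open>b\<close> are opposite to those in \<open>A_coeffs\<close>
    because \<open>x3\<close> and \<open>x4\<close> are congruent to \<open>-(t^2)\<close> modulo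
    \<open>m\<close>.\<close>
  define K where "K = a * ?e 1 - a * ?e 2 - b * ?e 3 + b * ?e 4"
  have "2 \<le> \<bar>t\<bar>" using t by auto
  then have t2: "4 \<le> t^2"
    using power_mono[of 2 "\<bar>t\<bar>" 2] by simp
  then have ab: "0 < b" "b < a" by (auto simp: a_def b_def)
  have m: "m > 0" using big t2 by linarith
  have "sum ?f I = (\<Sum>i\<in>{0..4}. if i \<in> I then ?f i else 0)"
    using I by (simp add: sum.inter_restrict[symmetric] Int_absorb1 psubset_imp_subset)
  also have "\<dots> = (\<Sum>i\<in>{0..4}. ?f i * ?e i)"
    by (intro sum.cong) auto
  also have "\<dots> = U * ?e 0 + a * x1^5 * ?e 1 - a * x2^5 * ?e 2 + b * x3^5 * ?e 3 - b * x4^5 * ?e 4"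
    unfolding sum_atLeast0_atMost4 A_coeffs_def quintic_point_def
      U_def x1_def x2_def x3_def x4_def a_def b_def
    by (simp add: algebra_simps)
  finally have S: "U * ?e 0 + a * x1^5 * ?e 1 - a * x2^5 * ?e 2 + b * x3^5 * ?e 3 - b * x4^5 * ?e 4 = 0"
    using zero by simp
  have x: "m dvd x1 - t^2" "m dvd x2 - t^2" "m dvd x3 - (- (t^2))" "m dvd x4 - (- (t^2))"
    by (simp_all add: x1_def x2_def x3_def x4_def power2_eq_square)
  have "m dvd U" by (simp add: U_def)
  then have "m dvd U * ?e 0 + a * ?e 1 * (x1^5 - (t^2)^5) - a * ?e 2 * (x2^5 - (t^2)^5)
      + b * ?e 3 * (x3^5 - (- (t^2))^5) - b * ?e 4 * (x4^5 - (- (t^2))^5)"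
    using x
    by (metis (no_types, lifting) dvd_add dvd_diff dvd_mult dvd_mult2 dvd_power_diff_self)
  also have "\<dots> = - (t^10 * K)"
    using S unfolding K_def by algebra
  finally have "m dvd K"
    using cop by (simp add: coprime_dvd_mult_right_iff)
  \<comment> \<open>At most \<open>a + b = 2 * t^2\<close> in absolute value.\<close>
  moreover have "\<bar>K\<bar> < m"
    using big t2 by (auto simp: K_def a_def b_def of_bool_def)
  ultimately have "K = 0"
    using zdvd_imp_le[of m "\<bar>K\<bar>"] by fastforce
  then have e: "1 \<in> I \<longleftrightarrow> 2 \<in> I" "3 \<in> I \<longleftrightarrow> 4 \<in> I"
    using signed_sum_eq_0_cases[OF ab] unfolding K_def by blast+
  define V W where "V = a * (x1^5 - x2^5)" and "W = b * (x3^5 - x4^5)"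
  have UVW: "U + V + W = 0"
    using quintic_identity[of t m]
    unfolding U_def V_def W_def x1_def x2_def x3_def x4_def a_def b_def .
  have "t^8 = (t^2)^4" by simp
  also have "\<dots> \<ge> 4^4" using t2 by (intro power_mono) auto
  finally have U: "U \<noteq> 0" using m t2 by (auto simp: U_def)
  have "x2^5 < x1^5" "x3^5 < x4^5"
    using m ab by (auto intro!: odd_power_strict_mono simp: x1_def x2_def x3_def x4_def)
  then have VW: "V \<noteq> 0" "W \<noteq> 0" using ab by (auto simp: V_def W_def)
  \<comment> \<open>By \<open>e\<close> the sub-sum is a partial sum of
    \<open>U + V + W = 0\<close>. One term alone is nonzero, and two terms give minus the third, so
    only none or all three can vanish.\<close>
  have red: "U * ?e 0 + V * ?e 1 + W * ?e 3 = 0"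
    using S e unfolding V_def W_def by (simp add: algebra_simps)
  have "(0 \<in> I \<longleftrightarrow> 1 \<in> I) \<and> (0 \<in> I \<longleftrightarrow> 3 \<in> I)"
    using red UVW U VW by (cases "0 \<in> I"; cases "1 \<in> I"; cases "3 \<in> I") auto
  moreover have "{0..4::nat} = {0, 1, 2, 3, 4}" by auto
  ultimately show False
    using e I by auto
qed

theorem theorem3p1:
  fixes t :: int
  assumes "t \<notin> {-1, 0, 1}"
  shows "infinite {X. nontrivial_point (A_coeffs t) X}"
proof -
  \<comment> \<open>Being 1 modulo \<open>t\<close> makes \<open>m k\<close> coprime to
    \<open>t\<close>; the summand 4 yields \<open>m k > 4 * t^2\<close>.\<close>
  define m where "m k = 1 + t^2 * (4 + int k)" for k
  have t2: "t^2 > 0" using assms by simp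
  have "nontrivial_point (A_coeffs t) (quintic_point t (m k))" for k
  proof -
    have "coprime (1 + t * (t * (4 + int k))) t"
      by (metis coprime_1_left coprime_iff_gcd_eq_1 gcd.commute gcd_add_mult mult.commute add.commute)
    then have "coprime (m k) t"
      by (simp add: m_def power2_eq_square mult.assoc)
    moreover have "m k > 4 * t^2"
      using t2 by (simp add: m_def algebra_simps add_pos_nonneg)
    ultimately show ?thesis
      using assms quintic_subsum_nonzero
      by (simp add: nontrivial_point_def quintic_point_on_variety Gcd_quintic_point)
  qed
  then have "range (\<lambda>k. quintic_point t (m k)) \<subseteq> {X. nontrivial_point (A_coeffs t) X}"
    by auto
  \<comment> \<open>The first coordinate \<open>m k\<close> already determines \<open>k\<close>, as
    \<open>t^2 > 0\<close>.\<close>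
  moreover have "inj (\<lambda>k. quintic_point t (m k))"
    using t2 by (auto intro!: injI simp: quintic_point_def m_def)
  ultimately show ?thesis
    using finite_imageD[of _ UNIV] finite_subset infinite_UNIV_nat by blast
qed

end
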